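(* Let $S_{I,SG}=\lim_{n\to\infty}\frac{\ln I(n)}{v(SG(n))}$ be the entropy per site for the number $I(n)$ of ice model configurations on the two-dimensional Sierpinski gasket $SG(n)$, where $v(SG(n))=\frac32(3^n+1)$ is the number of vertices. For every positive integer $m$, $$\frac{2}{3^{m+1}}\ln pc(m)+\frac{2}{3^m}\ln 2\ \le\ S_{I,SG}\ \le\ \frac{2}{3^{m+1}}\ln pd(m)+\frac{2}{3^m}\ln 2 .$$
   Context: The two-dimensional Sierpinski gasket graphs $SG(n)$, $n\ge 0$, are defined recursively. $SG(0)$ is a triangle (three vertices, three edges), drawn as an equilateral triangle, with all three vertices called outmost. $SG(n+1)$ is obtained by subdividing a larger equilateral triangle into four congruent equilateral triangles, placing a copy of $SG(n)$ in each of the three corner triangles (bottom left, bottom right, top; not in the middle one), and identifying the outmost vertices of different copies that coincide (each pair of copies shares exactly one vertex). The outmost vertices of $SG(n+1)$ are the three corners of the large triangle. $SG(n)$ has $3^{n+1}$ edges and $\frac32(3^n+1)$ vertices; the three outmost vertices have degree 2 and all others have degree 4. An ice model configuration on $SG(n)$ is an assignment of an orientation to every edge such that at every vertex of degree 4 exactly two incident edges point toward the vertex and two point away. No condition is imposed at the three outmost vertices. $I(n)$ is the number of such configurations. Denote the outmost vertices of $SG(n)$ by $L$ (bottom left), $R$ (bottom right), $T$ (top). Each outmost vertex has exactly two incident edges, one lying on each of the two sides of the big triangle meeting at that corner; sides are denoted $LT$, $TR$, $LR$. An edge at an outmost vertex is called "in" if it points toward that vertex and "out" otherwise. Then: - $pc(n)$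 is the number of ice model configurations on $SG(n)$ for which: at $T$ the edge on $TR$ is in and the edge on $LT$ is out; at $R$ the edge on $TR$ is in and the edge on $LR$ is out; at $L$ the edge on $LR$ is in and the edge on $LT$ is out. - $pd(n)$ is the number of ice model configurations on $SG(n)$ for which: at $T$ the edge on $LT$ is in and the edge on $TR$ is out; at $R$ the edge on $TR$ is in and the edge on $LR$ is out; at $L$ the edge on $LR$ is in and the edge on $LT$ is out. *)

theory Defs
  imports Complex_Main "HOL-Library.FuncSet"
begin

text \<open>
  A point \<open>(x, y)\<close> stands for the point \<open>x * a + y * b\<close> of the triangular lattice, where \<open>a\<close> is the
  unit vector pointing right and \<open>b\<close> the unit vector at 60 degrees to it. The big triangle of
  \<open>SG(n)\<close> has side length \<open>2^n\<close>. Because the copies are placed in the plane, outmost vertices of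
  different copies that coincide are identified automatically.
\<close>

type_synonym point = "nat \<times> nat"

definition vL :: "nat \<Rightarrow> point" where "vL n = (0, 0)"
definition vR :: "nat \<Rightarrow> point" where "vR n = (2 ^ n, 0)"
definition vT :: "nat \<Rightarrow> point" where "vT n = (0, 2 ^ n)"

definition shift :: "point \<Rightarrow> point \<Rightarrow> point" where
  "shift d p = (fst d + fst p, snd d + snd p)"

fun sg_verts :: "nat \<Rightarrow> point set" where
  "sg_verts 0 = {vL 0, vR 0, vT 0}"
| "sg_verts (Suc n) =
     sg_verts n \<union> shift (vR n) ` sg_verts n \<union> shift (vT n) ` sg_verts n"

fun sg_edges :: "nat \<Rightarrow> point set set" where
  "sg_edges 0 = {{vL 0, vR 0}, {vL 0, vT 0}, {vT 0, vR 0}}"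
| "sg_edges (Suc n) =
     sg_edges n \<union> (`) (shift (vR n)) ` sg_edges n \<union> (`) (shift (vT n)) ` sg_edges n"

definition sg_degree :: "nat \<Rightarrow> point \<Rightarrow> nat" where
  "sg_degree n v = card {e \<in> sg_edges n. v \<in> e}"

text \<open>
  An orientation assigns to every edge the endpoint it points toward; it is extensional
  (\<open>undefined\<close> outside the edge set), so that each orientation is counted once.
\<close>

definition orientations :: "nat \<Rightarrow> (point set \<Rightarrow> point) set" where
  "orientations n = (\<Pi>\<^sub>E e\<in>sg_edges n. e)"

definition ice_configs :: "nat \<Rightarrow> (point set \<Rightarrow> point) set" where
  "ice_configs n = {h \<in> orientations n. \<forall>v\<in>sg_verts n. sg_degree n v = 4 \<longrightarrow>
     card {e \<in> sg_edges n. v \<in> e \<and> h e = v} = 2 \<and>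
     card {e \<in> sg_edges n. v \<in> e \<and> h e \<noteq> v} = 2}"

definition I_count :: "nat \<Rightarrow> nat" where
  "I_count n = card (ice_configs n)"

text \<open>
  The lines carrying the sides of the big triangle. An edge of \<open>SG(n)\<close> lies on a side iff both
  of its endpoints do.
\<close>

definition side_LT :: "nat \<Rightarrow> point set" where "side_LT n = {(x, y). x = 0}"
definition side_LR :: "nat \<Rightarrow> point set" where "side_LR n = {(x, y). y = 0}"
definition side_TR :: "nat \<Rightarrow> point set" where "side_TR n = {(x, y). x + y = 2 ^ n}"

text \<open>
  For an outmost vertex \<open>v\<close> and a side \<open>s\<close> through it, there is exactly one edge at \<open>v\<close> lying
  on \<open>s\<close>; the following say that it points toward, respectively away from, \<open>v\<close>.
\<close>

definition edge_in :: "nat \<Rightarrow> (point set \<Rightarrow> point) \<Rightarrow> point \<Rightarrow> point set \<Rightarrow> bool" where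
  "edge_in n h v s \<longleftrightarrow> (\<exists>e\<in>sg_edges n. v \<in> e \<and> e \<subseteq> s \<and> h e = v)"

definition edge_out :: "nat \<Rightarrow> (point set \<Rightarrow> point) \<Rightarrow> point \<Rightarrow> point set \<Rightarrow> bool" where
  "edge_out n h v s \<longleftrightarrow> (\<exists>e\<in>sg_edges n. v \<in> e \<and> e \<subseteq> s \<and> h e \<noteq> v)"

definition pc :: "nat \<Rightarrow> nat" where
  "pc n = card {h \<in> ice_configs n.
     edge_in n h (vT n) (side_TR n) \<and> edge_out n h (vT n) (side_LT n) \<and>
     edge_in n h (vR n) (side_TR n) \<and> edge_out n h (vR n) (side_LR n) \<and>
     edge_in n h (vL n) (side_LR n) \<and> edge_out n h (vL n) (side_LT n)}"

definition pd :: "nat \<Rightarrow> nat" where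
  "pd n = card {h \<in> ice_configs n.
     edge_in n h (vT n) (side_LT n) \<and> edge_out n h (vT n) (side_TR n) \<and>
     edge_in n h (vR n) (side_TR n) \<and> edge_out n h (vR n) (side_LR n) \<and>
     edge_in n h (vL n) (side_LR n) \<and> edge_out n h (vL n) (side_LT n)}"

definition entropy_seq :: "nat \<Rightarrow> real" where
  "entropy_seq n = ln (real (I_count n)) / real (card (sg_verts n))"

definition S_I_SG :: real where
  "S_I_SG = lim entropy_seq"

end

theory Submission
  imports Defs
begin

text \<open>
  In an ice configuration the in-degrees of the three outmost vertices sum to 3, so up to symmetry
  and reversal there are four classes of boundary states. Let \<open>c = pc n\<close> and \<open>d = pd n\<close> be the
  numbers of configurations with a given boundary state in the two classes with in-degrees
  (1,1,1), and \<open>a\<close>, \<open>b\<close> the numbers for the two classes with in-degrees (0,1,2). Gluing three copies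
  gives a cubic recursion for \<open>(a, b, c, d)\<close>. With \<open>s = d + 3 c\<close> and \<open>p = a + b\<close> it yields
  \<open>I = 6 p + 2 s\<close> and \<open>s' = 4 s\<^sup>3 + p\<^sup>3\<close> with \<open>p \<le> s\<close>, so \<open>ln I / 3\<^sup>n\<close> and \<open>ln s / 3\<^sup>n\<close> converge to the same
  limit. The bounds are \<open>ln (8 c) / 3\<^sup>n\<close> and \<open>ln (8 d) / 3\<^sup>n\<close>: since \<open>4 c \<le> s \<le> 4 d\<close>, it suffices that
  the first is increasing and the second decreasing, that is, \<open>c' \<ge> 64 c\<^sup>3\<close> and \<open>d' \<le> 64 d\<^sup>3\<close>. Only
  the last inequality is delicate: it needs \<open>d - c\<close> not to be too small compared with \<open>a\<^sup>3 / s\<^sup>2\<close>.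
\<close>

section \<open>Gluing three copies of the gasket\<close>

text \<open>
  Each corner of \<open>SG(n)\<close> is also the translation vector of the copy placed at it. So the
  copy at \<open>d\<close> has its own corner in the direction of \<open>d'\<close> at \<open>shift d d'\<close>, and the corners of \<open>SG(n + 1)\<close>
  are the points \<open>shift d d\<close>.
\<close>

definition corners :: "nat \<Rightarrow> point set" where
  "corners n = {vL n, vR n, vT n}"

lemmas corner_defs = corners_def vL_def vR_def vT_def

lemma shift_Pair [simp]: "shift (a, b) (x, y) = (a + x, b + y)"
  by (simp add: shift_def)

lemma shift_commute: "shift d p = shift p d"
  by (simp add: shift_def add.commute)

lemma inj_shift: "inj (shift d)"
  by (rule injI) (auto simp: shift_def prod_eq_iff)

lemma shift_eq_iff [simp]: "shift d p = shift d q \<longleftrightarrow> p = q"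
  by (rule inj_eq[OF inj_shift])

lemma shift_image_eq_iff [simp]: "shift d ` e = shift d ` f \<longleftrightarrow> e = f"
  by (rule inj_image_eq_iff[OF inj_shift])

lemma shift_mem_image_iff [simp]: "shift d p \<in> shift d ` e \<longleftrightarrow> p \<in> e"
  by (rule inj_image_mem_iff[OF inj_shift])

lemma shift_zero [simp]: "shift (0, 0) = id"
  by (auto simp: shift_def)

lemma sg_verts_Suc: "sg_verts (Suc n) = (\<Union>d\<in>corners n. shift d ` sg_verts n)"
  by (auto simp: corners_def vL_def)

lemma sg_edges_Suc: "sg_edges (Suc n) = (\<Union>d\<in>corners n. (`) (shift d) ` sg_edges n)"
  by (auto simp: corners_def vL_def)

declare sg_verts.simps(2) [simp del] sg_edges.simps(2) [simp del]

lemma corners_Suc: "corners (Suc n) = (\<lambda>d. shift d d) ` corners n"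
  by (simp add: corner_defs mult_2)

lemma finite_verts [simp]: "finite (sg_verts n)"
  by (induction n) (auto simp: sg_verts_Suc corners_def)

lemma finite_edges [simp]: "finite (sg_edges n)"
  by (induction n) (auto simp: sg_edges_Suc corners_def)

lemma corners_subset_verts: "corners n \<subseteq> sg_verts n"
proof (induction n)
  case (Suc n)
  then show ?case unfolding corners_Suc sg_verts_Suc by blast
qed (simp add: corners_def)

lemma verts_bound: "p \<in> sg_verts n \<Longrightarrow> fst p + snd p \<le> 2 ^ n"
proof (induction n arbitrary: p)
  case (Suc n)
  then obtain d q where "p = shift d q" "d \<in> corners n" "q \<in> sg_verts n"
    by (auto simp: sg_verts_Suc)
  with Suc.IH[of q] show ?case by (auto simp: corner_defs shift_def)
qed (auto simp: corner_defs)

lemma edges_subset_verts: "e \<in> sg_edges n \<Longrightarrow> e \<subseteq> sg_verts n"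
proof (induction n arbitrary: e)
  case (Suc n)
  then show ?case unfolding sg_edges_Suc sg_verts_Suc by blast
qed auto

lemma card_edge: "e \<in> sg_edges n \<Longrightarrow> card e = 2"
proof (induction n arbitrary: e)
  case (Suc n)
  then show ?case
    by (auto simp: sg_edges_Suc card_image inj_on_subset[OF inj_shift subset_UNIV])
qed (auto simp: corner_defs)

text \<open>Hence the copies at \<open>d\<close> and \<open>d'\<close> meet exactly in \<open>shift d d' = shift d' d\<close>.\<close>

lemma shift_eqD:
  assumes "shift d p = shift d' q" "d \<noteq> d'" "d \<in> corners n" "d' \<in> corners n"
    "p \<in> sg_verts n" "q \<in> sg_verts n"
  shows "p = d'" "q = d"
  \<comment> \<open>In every case some coordinate of \<open>p\<close> or \<open>q\<close> is at
    least \<open>2 ^ n\<close>; the bound on the coordinate sums then fixes both points.\<close>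
  using assms verts_bound[of p n] verts_bound[of q n]
  by (auto simp: corner_defs shift_def prod_eq_iff)

text \<open>Two copies share a single point, whereas an edge has two endpoints, so no edge lies in
  two copies.\<close>

lemma shift_edge_eqD:
  assumes "shift d ` e = shift d' ` f" "d \<in> corners n" "d' \<in> corners n"
    "e \<in> sg_edges n" "f \<in> sg_edges n"
  shows "d = d' \<and> e = f"
proof -
  have "d = d'"
  proof (rule ccontr)
    assume "d \<noteq> d'"
    have "e \<subseteq> {d'}"
    proof
      fix p assume "p \<in> e"
      then obtain q where "q \<in> f" "shift d p = shift d' q" using assms(1) by blast
      then show "p \<in> {d'}"
        using shift_eqD(1)[of d p d' q n] \<open>d \<noteq> d'\<close> \<open>p \<in> e\<close> assms edges_subset_verts by blast
    qed
    then have "card e \<le> 1" using card_mono[of "{d'}" e] by simp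
    then show False using card_edge[OF assms(4)] by simp
  qed
  then show ?thesis using assms(1) by simp
qed

lemma bij_betw_edges:
  "bij_betw (\<lambda>(d, f). shift d ` f) (corners n \<times> sg_edges n) (sg_edges (Suc n))"
  unfolding bij_betw_def
  by (auto simp: inj_on_def sg_edges_Suc dest: shift_edge_eqD)

text \<open>The hypothesis on \<open>p\<close> still admits \<open>p = d\<close>: the corner
  \<open>shift d d\<close> of the larger gasket lies in one copy only, like an interior vertex of a
  copy. Joints lie in two copies and need a separate treatment.\<close>

lemma incident_shift_interior:
  assumes "d \<in> corners n" "p \<in> sg_verts n" "p \<notin> corners n - {d}"
  shows "{e \<in> sg_edges (Suc n). shift d p \<in> e} = (`) (shift d) ` {f \<in> sg_edges n. p \<in> f}"
proof -
  have "d' = d" if "d' \<in> corners n" "f \<in> sg_edges n" "shift d p \<in> shift d' ` f" for d' f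
    using that assms edges_subset_verts shift_eqD(1)[of d p d' _ n] by blast
  with assms(1) have "e \<in> sg_edges (Suc n) \<and> shift d p \<in> e
      \<longleftrightarrow> (\<exists>f\<in>sg_edges n. e = shift d ` f \<and> shift d p \<in> shift d ` f)" for e
    unfolding sg_edges_Suc by blast
  then show ?thesis by auto
qed

lemma incident_shift_joint:
  assumes "d \<in> corners n" "d' \<in> corners n" "d \<noteq> d'"
  shows "{e \<in> sg_edges (Suc n). shift d d' \<in> e}
    = (`) (shift d) ` {f \<in> sg_edges n. d' \<in> f} \<union> (`) (shift d') ` {f \<in> sg_edges n. d \<in> f}"
proof -
  have d': "d' \<in> sg_verts n" using assms corners_subset_verts by blast
  have "d'' = d'" if "d'' \<in> corners n" "f \<in> sg_edges n" "shift d d' \<in> shift d'' ` f" "d'' \<noteq> d"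
    for d'' f
    using that assms d' edges_subset_verts shift_eqD(1)[of d d' d'' _ n] by blast
  note only = this
  have d: "shift d d' \<in> shift d' ` f \<longleftrightarrow> d \<in> f" for f
    using shift_commute[of d d'] by simp
  show ?thesis
  proof (intro equalityI subsetI)
    fix e assume "e \<in> {e \<in> sg_edges (Suc n). shift d d' \<in> e}"
    then obtain d'' f where f: "d'' \<in> corners n" "f \<in> sg_edges n" "e = shift d'' ` f"
      "shift d d' \<in> shift d'' ` f" unfolding sg_edges_Suc by blast
    show "e \<in> (`) (shift d) ` {f \<in> sg_edges n. d' \<in> f}
      \<union> (`) (shift d') ` {f \<in> sg_edges n. d \<in> f}"
    proof (cases "d'' = d")
      case False
      then have "d'' = d'" using only f by blast
      with f d show ?thesis by simp
    qed (use f in simp)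
  next
    fix e assume "e \<in> (`) (shift d) ` {f \<in> sg_edges n. d' \<in> f} \<union> (`) (shift d') ` {f \<in> sg_edges n. d \<in> f}"
    then show "e \<in> {e \<in> sg_edges (Suc n). shift d d' \<in> e}"
      unfolding sg_edges_Suc using assms(1,2) d by auto
  qed
qed

text \<open>With \<open>Q\<close> constantly true this yields degrees; with \<open>Q\<close> saying
  that the edge points toward the vertex, it yields in-degrees. The counterpart for joints serves
  the same two purposes.\<close>

lemma card_incident_interior:
  assumes "d \<in> corners n" "p \<in> sg_verts n" "p \<notin> corners n - {d}"
  shows "card {e \<in> sg_edges (Suc n). shift d p \<in> e \<and> Q e}
    = card {f \<in> sg_edges n. p \<in> f \<and> Q (shift d ` f)}"
proof -
  have "{e \<in> sg_edges (Suc n). shift d p \<in> e \<and> Q e}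
      = {e \<in> {e \<in> sg_edges (Suc n). shift d p \<in> e}. Q e}" by auto
  also have "\<dots> = (`) (shift d) ` {f \<in> sg_edges n. p \<in> f \<and> Q (shift d ` f)}"
    unfolding incident_shift_interior[OF assms] by auto
  finally show ?thesis by (simp add: card_image inj_on_def)
qed

lemma card_incident_joint:
  assumes "d \<in> corners n" "d' \<in> corners n" "d \<noteq> d'"
  shows "card {e \<in> sg_edges (Suc n). shift d d' \<in> e \<and> Q e}
    = card {f \<in> sg_edges n. d' \<in> f \<and> Q (shift d ` f)}
    + card {f \<in> sg_edges n. d \<in> f \<and> Q (shift d' ` f)}"
proof -
  let ?A = "{f \<in> sg_edges n. d' \<in> f \<and> Q (shift d ` f)}"
  let ?B = "{f \<in> sg_edges n. d \<in> f \<and> Q (shift d' ` f)}"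
  have "{e \<in> sg_edges (Suc n). shift d d' \<in> e \<and> Q e}
      = {e \<in> {e \<in> sg_edges (Suc n). shift d d' \<in> e}. Q e}" by auto
  also have "\<dots> = (`) (shift d) ` ?A \<union> (`) (shift d') ` ?B"
    unfolding incident_shift_joint[OF assms] by auto
  finally have "card {e \<in> sg_edges (Suc n). shift d d' \<in> e \<and> Q e}
      = card ((`) (shift d) ` ?A \<union> (`) (shift d') ` ?B)" by simp
  also have "\<dots> = card ((`) (shift d) ` ?A) + card ((`) (shift d') ` ?B)"
  proof (rule card_Un_disjoint)
    show "(`) (shift d) ` ?A \<inter> (`) (shift d') ` ?B = {}"
      using shift_edge_eqD[of d _ d' _ n] assms by blast
  qed simp_all
  finally show ?thesis by (simp add: card_image inj_on_def)
qed

lemma verts_Suc_cases: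
  assumes "v \<in> sg_verts (Suc n)"
  obtains (inner) d p where "v = shift d p" "d \<in> corners n" "p \<in> sg_verts n - corners n"
    | (joint) d d' where "v = shift d d'" "d \<in> corners n" "d' \<in> corners n" "d \<noteq> d'"
    | (corner) d where "v = shift d d" "d \<in> corners n"
proof -
  from assms obtain d p where "v = shift d p" "d \<in> corners n" "p \<in> sg_verts n"
    unfolding sg_verts_Suc by blast
  then show thesis using that by (cases "p \<in> corners n"; cases "p = d") auto
qed

section \<open>Edges at the corners, degrees and the number of vertices\<close>

text \<open>A corner has only edges of the copy placed there, so the induction merely translates the
  list. The edges listed first lie on LR, TR and LT respectively, the order used later for corner
  states.\<close>

lemma incident_corner:
  "{e \<in> sg_edges n. vL n \<in> e} = {{(0, 0), (1, 0)}, {(0, 0), (0, 1)}}"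
  "{e \<in> sg_edges n. vR n \<in> e} = {{(2 ^ n, 0), (2 ^ n - 1, 1)}, {(2 ^ n, 0), (2 ^ n - 1, 0)}}"
  "{e \<in> sg_edges n. vT n \<in> e} = {{(0, 2 ^ n), (0, 2 ^ n - 1)}, {(0, 2 ^ n), (1, 2 ^ n - 1)}}"
proof (induction n)
  case 0
  case 1 show ?case by (auto simp: vL_def vR_def vT_def)
  case 2 show ?case by (auto simp: vL_def vR_def vT_def)
  case 3 show ?case by (auto simp: vL_def vR_def vT_def)
next
  case (Suc n)
  \<comment> \<open>Truncated subtraction is compatible with the translation because
    \<open>2 ^ n\<close> is at least 1.\<close>
  have pow: "2 ^ Suc n = (2 ^ n + 2 ^ n :: nat)" "2 ^ n + 2 ^ n - 1 = 2 ^ n + (2 ^ n - 1 :: nat)"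
    by (simp_all add: mult_2)
  have *: "{e \<in> sg_edges (Suc n). shift d d \<in> e} = (`) (shift d) ` {f \<in> sg_edges n. d \<in> f}"
    if "d \<in> corners n" for d
    using that corners_subset_verts by (intro incident_shift_interior) auto
  have eq: "vL (Suc n) = shift (vL n) (vL n)" "vR (Suc n) = shift (vR n) (vR n)"
    "vT (Suc n) = shift (vT n) (vT n)" by (auto simp: corner_defs mult_2)
  note simps = image_insert image_empty shift_Pair add_0_left add_0_right
  case 1
  have "{e \<in> sg_edges (Suc n). vL (Suc n) \<in> e} = (`) (shift (vL n)) ` {f \<in> sg_edges n. vL n \<in> f}"
    unfolding eq by (rule *) (simp add: corners_def)
  then show ?case unfolding Suc.IH by (simp only: simps vL_def)
  case 2
  have "{e \<in> sg_edges (Suc n). vR (Suc n) \<in> e} = (`) (shift (vR n)) ` {f \<in> sg_edges n. vR n \<in> f}"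
    unfolding eq by (rule *) (simp add: corners_def)
  then show ?case unfolding Suc.IH pow by (simp only: simps vR_def)
  case 3
  have "{e \<in> sg_edges (Suc n). vT (Suc n) \<in> e} = (`) (shift (vT n)) ` {f \<in> sg_edges n. vT n \<in> f}"
    unfolding eq by (rule *) (simp add: corners_def)
  then show ?case unfolding Suc.IH pow by (simp only: simps vT_def)
qed

lemma card_incident_corner: "d \<in> corners n \<Longrightarrow> card {e \<in> sg_edges n. d \<in> e} = 2"
  by (auto simp: corners_def incident_corner doubleton_eq_iff)

text \<open>A joint receives two edges from each of its two copies; every other vertex keeps the
  degree it has in its copy. So the ice rule constrains exactly the vertices outside
  \<open>corners n\<close>.\<close>

lemma sg_degree_eq: "v \<in> sg_verts n \<Longrightarrow> sg_degree n v = (if v \<in> corners n then 2 else 4)"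
proof (induction n arbitrary: v)
  case 0
  then show ?case using card_incident_corner[of v 0] by (auto simp: sg_degree_def corners_def)
next
  case (Suc n)
  show ?case
  proof (cases "v \<in> corners (Suc n)")
    case True
    then show ?thesis using card_incident_corner by (simp add: sg_degree_def)
  next
    case False
    from Suc.prems show ?thesis
    proof (cases rule: verts_Suc_cases)
      case (inner d p)
      then show ?thesis
        using False Suc.IH[of p] card_incident_interior[of d n p "\<lambda>_. True"]
        by (simp add: sg_degree_def)
    next
      case (joint d d')
      then show ?thesis
        using False card_incident_joint[of d n d' "\<lambda>_. True"] card_incident_corner[of _ n]
        by (simp add: sg_degree_def)
    next
      case (corner d)
      then show ?thesis using False by (simp add: corners_Suc)
    qed
  qed
qed

text \<open>The copies at L and R share one vertex, and their union shares two distinct vertices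
  with the copy at T, so three vertices are counted twice. Doubling avoids division in the
  naturals.\<close>

lemma card_verts: "2 * card (sg_verts n) = 3 ^ Suc n + 3"
proof (induction n)
  case 0
  then show ?case by (simp add: corner_defs)
next
  case (Suc n)
  let ?V = "sg_verts n" and ?L = "vL n" and ?R = "vR n" and ?T = "vT n"
  have mem: "?L \<in> ?V" "?R \<in> ?V" "?T \<in> ?V"
    using corners_subset_verts[of n] by (auto simp: corners_def)
  have ne: "?L \<noteq> ?R" "?L \<noteq> ?T" "?R \<noteq> ?T" by (auto simp: corner_defs)
  have int: "shift d ` ?V \<inter> shift d' ` ?V = {shift d d'}"
    if "d \<in> corners n" "d' \<in> corners n" "d \<noteq> d'" for d d'
  proof -
    have "shift d d' \<in> shift d ` ?V" "shift d' d \<in> shift d' ` ?V"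
      using that corners_subset_verts[of n] by auto
    moreover have "v = shift d d'" if "v \<in> shift d ` ?V" "v \<in> shift d' ` ?V" for v
    proof -
      from that obtain p q where "v = shift d p" "v = shift d' q" "p \<in> ?V" "q \<in> ?V" by blast
      then show ?thesis using shift_eqD(1)[of d p d' q n] \<open>d \<in> corners n\<close> \<open>d' \<in> corners n\<close> \<open>d \<noteq> d'\<close>
        by simp
    qed
    ultimately show ?thesis unfolding shift_commute[of d' d] by blast
  qed
  have card: "card (shift d ` ?V) = card ?V" for d by (simp add: card_image inj_on_def)
  have LR: "card (shift ?L ` ?V \<union> shift ?R ` ?V) + 1 = 2 * card ?V"
    using card_Un_Int[of "shift ?L ` ?V" "shift ?R ` ?V"] int[of ?L ?R] ne
    by (simp add: card corners_def)
  have "(shift ?L ` ?V \<union> shift ?R ` ?V) \<inter> shift ?T ` ?V = {shift ?L ?T, shift ?R ?T}"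
    using int[of ?L ?T] int[of ?R ?T] ne by (auto simp: corners_def)
  moreover have "shift ?L ?T \<noteq> shift ?R ?T" by (auto simp: corner_defs)
  ultimately have "card (shift ?L ` ?V \<union> shift ?R ` ?V \<union> shift ?T ` ?V) + 3 = 3 * card ?V"
    using card_Un_Int[of "shift ?L ` ?V \<union> shift ?R ` ?V" "shift ?T ` ?V"] LR
    by (simp add: card)
  then show ?case using Suc by (simp add: sg_verts_Suc corners_def Un_assoc)
qed

section \<open>Transfer of boundary states\<close>

definition indeg :: "nat \<Rightarrow> (point set \<Rightarrow> point) \<Rightarrow> point \<Rightarrow> nat" where
  "indeg n h v = card {e \<in> sg_edges n. v \<in> e \<and> h e = v}"

text \<open>At a vertex of degree 4, in-degree 2 already forces out-degree 2.\<close>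

lemma ice_configs_iff:
  "h \<in> ice_configs n \<longleftrightarrow>
     h \<in> orientations n \<and> (\<forall>v\<in>sg_verts n - corners n. indeg n h v = 2)"
proof -
  have "card {e \<in> sg_edges n. v \<in> e \<and> h e \<noteq> v} = sg_degree n v - indeg n h v" for v
  proof -
    have "{e \<in> sg_edges n. v \<in> e \<and> h e \<noteq> v}
        = {e \<in> sg_edges n. v \<in> e} - {e \<in> sg_edges n. v \<in> e \<and> h e = v}" by auto
    then show ?thesis
      by (simp only: sg_degree_def indeg_def) (rule card_Diff_subset, auto)
  qed
  then show ?thesis
    unfolding ice_configs_def indeg_def[symmetric] by (auto simp: sg_degree_eq split: if_splits)
qed

lemma finite_orientations [simp]: "finite (orientations n)"
proof -
  have "finite e" if "e \<in> sg_edges n" for e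
    using finite_subset[OF edges_subset_verts[OF that]] by simp
  then show ?thesis unfolding orientations_def by (intro finite_PiE) auto
qed

section \<open>Cutting an orientation into three slices and reassembling it\<close>

text \<open>Subtraction of naturals truncates, so this inverts \<open>shift d\<close> only on points
  of the form \<open>shift d p\<close>.\<close>

definition unshift :: "point \<Rightarrow> point \<Rightarrow> point" where
  "unshift d p = (fst p - fst d, snd p - snd d)"

lemma unshift_shift [simp]: "unshift d (shift d p) = p"
  by (simp add: unshift_def shift_def)

text \<open>The part of \<open>h\<close> on the copy at \<open>d\<close>, moved back to the origin.
  Restricting to \<open>sg_edges n\<close> keeps it extensional.\<close>

definition slice :: "nat \<Rightarrow> point \<Rightarrow> (point set \<Rightarrow> point) \<Rightarrow> point set \<Rightarrow> point" where
  "slice n d h = (\<lambda>f\<in>sg_edges n. unshift d (h (shift d ` f)))"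

lemma orientations_shift:
  assumes "h \<in> orientations (Suc n)" "d \<in> corners n" "f \<in> sg_edges n"
  shows "h (shift d ` f) \<in> shift d ` f"
proof -
  have "shift d ` f \<in> sg_edges (Suc n)" using assms(2,3) unfolding sg_edges_Suc by blast
  with assms(1) show ?thesis unfolding orientations_def by (rule PiE_mem)
qed

text \<open>An orientation picks an endpoint of the edge, here a point translated by
  \<open>d\<close>, so \<open>unshift\<close> truncates nothing.\<close>

lemma shift_slice:
  assumes "h \<in> orientations (Suc n)" "d \<in> corners n" "f \<in> sg_edges n"
  shows "shift d (slice n d h f) = h (shift d ` f)"
  using orientations_shift[OF assms] assms(3) by (auto simp: slice_def)

lemma slice_eq_iff:
  assumes "h \<in> orientations (Suc n)" "d \<in> corners n" "f \<in> sg_edges n"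
  shows "slice n d h f = p \<longleftrightarrow> h (shift d ` f) = shift d p"
  unfolding shift_slice[OF assms, symmetric] by simp

lemma slice_orientations:
  assumes "h \<in> orientations (Suc n)" "d \<in> corners n"
  shows "slice n d h \<in> orientations n"
  unfolding orientations_def
proof (rule PiE_I)
  fix f assume f: "f \<in> sg_edges n"
  have "shift d (slice n d h f) \<in> shift d ` f"
    unfolding shift_slice[OF assms f] by (rule orientations_shift[OF assms f])
  then show "slice n d h f \<in> f" by simp
qed (simp add: slice_def)

text \<open>The edges of the larger gasket are the disjoint union of three copies, so orienting them
  amounts to three independent choices.\<close>

lemma bij_betw_slices:
  "bij_betw (\<lambda>h. (slice n (vL n) h, slice n (vR n) h, slice n (vT n) h))
     (orientations (Suc n)) (orientations n \<times> orientations n \<times> orientations n)"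
  (is "bij_betw ?s _ _")
proof -
  have c: "vL n \<in> corners n" "vR n \<in> corners n" "vT n \<in> corners n"
    by (auto simp: corners_def)
  have "inj_on ?s (orientations (Suc n))"
  proof (rule inj_onI)
    fix h h' assume h: "h \<in> orientations (Suc n)" "h' \<in> orientations (Suc n)" "?s h = ?s h'"
    show "h = h'"
    proof (rule PiE_ext[OF h(1,2)[unfolded orientations_def]])
      fix e assume "e \<in> sg_edges (Suc n)"
      then obtain d f where df: "d \<in> corners n" "f \<in> sg_edges n" "e = shift d ` f"
        unfolding sg_edges_Suc by blast
      have "slice n d h = slice n d h'" using h(3) df(1) by (auto simp: corners_def)
      then show "h e = h' e"
        using shift_slice[OF h(1) df(1,2)] shift_slice[OF h(2) df(1,2)] df(3) by simp
    qed
  qed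
  moreover have "?s ` orientations (Suc n) = orientations n \<times> orientations n \<times> orientations n"
  proof (intro equalityI subsetI)
    fix w assume "w \<in> orientations n \<times> orientations n \<times> orientations n"
    then obtain x y z where w: "w = (x, y, z)"
      and o: "x \<in> orientations n" "y \<in> orientations n" "z \<in> orientations n" by auto
    define g where "g d = (if d = vL n then x else if d = vR n then y else z)" for d
    define \<phi> :: "point \<times> point set \<Rightarrow> point set" where "\<phi> = (\<lambda>(d, f). shift d ` f)"
    \<comment> \<open>The inverse of the edge bijection tells in which copy an edge lies and which
      edge it is there.\<close>
    define h where "h = (\<lambda>e\<in>sg_edges (Suc n).
      case inv_into (corners n \<times> sg_edges n) \<phi> e of (d, f) \<Rightarrow> shift d (g d f))"
    have g: "g d \<in> orientations n" for d using o by (simp add: g_def)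
    have hs: "h (shift d ` f) = shift d (g d f)" if "d \<in> corners n" "f \<in> sg_edges n" for d f
    proof -
      have "inv_into (corners n \<times> sg_edges n) \<phi> (\<phi> (d, f)) = (d, f)"
        using bij_betw_edges[of n] that unfolding \<phi>_def by (intro inv_into_f_f bij_betw_imp_inj_on) auto
      moreover have "shift d ` f \<in> sg_edges (Suc n)" using that unfolding sg_edges_Suc by blast
      ultimately show ?thesis by (simp add: h_def \<phi>_def)
    qed
    have h: "h \<in> orientations (Suc n)"
      unfolding orientations_def
    proof (rule PiE_I)
      fix e assume "e \<in> sg_edges (Suc n)"
      then obtain d f where df: "d \<in> corners n" "f \<in> sg_edges n" "e = shift d ` f"
        unfolding sg_edges_Suc by blast
      have "g d f \<in> f" using g[of d] df(2) unfolding orientations_def by (rule PiE_mem)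
      then show "h e \<in> e" using hs[OF df(1,2)] df(3) by simp
    qed (simp add: h_def)
    have "slice n d h = g d" if "d \<in> corners n" for d
    proof (rule PiE_ext[OF slice_orientations[OF h that, unfolded orientations_def]
          g[of d, unfolded orientations_def]])
      fix f assume "f \<in> sg_edges n"
      then show "slice n d h f = g d f" using slice_eq_iff[OF h that] hs[OF that] by simp
    qed
    then have "?s h = w" using c by (simp add: w g_def) (simp add: corner_defs)
    with h show "w \<in> ?s ` orientations (Suc n)" by blast
  qed (auto intro!: slice_orientations c)
  ultimately show ?thesis by (simp add: bij_betw_def)
qed

lemma indeg_interior:
  assumes "h \<in> orientations (Suc n)" "d \<in> corners n" "p \<in> sg_verts n - corners n"
  shows "indeg (Suc n) h (shift d p) = indeg n (slice n d h) p"
proof -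
  have "indeg (Suc n) h (shift d p) = card {f \<in> sg_edges n. p \<in> f \<and> h (shift d ` f) = shift d p}"
    unfolding indeg_def using assms by (intro card_incident_interior) auto
  also have "{f \<in> sg_edges n. p \<in> f \<and> h (shift d ` f) = shift d p}
      = {f \<in> sg_edges n. p \<in> f \<and> slice n d h f = p}"
    using slice_eq_iff[OF assms(1,2)] by blast
  finally show ?thesis by (simp add: indeg_def)
qed

lemma indeg_joint:
  assumes "h \<in> orientations (Suc n)" "d \<in> corners n" "d' \<in> corners n" "d \<noteq> d'"
  shows "indeg (Suc n) h (shift d d') = indeg n (slice n d h) d' + indeg n (slice n d' h) d"
proof -
  have "indeg (Suc n) h (shift d d')
      = card {f \<in> sg_edges n. d' \<in> f \<and> h (shift d ` f) = shift d d'}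
      + card {f \<in> sg_edges n. d \<in> f \<and> h (shift d' ` f) = shift d d'}"
    unfolding indeg_def using assms by (intro card_incident_joint)
  also have "{f \<in> sg_edges n. d' \<in> f \<and> h (shift d ` f) = shift d d'}
      = {f \<in> sg_edges n. d' \<in> f \<and> slice n d h f = d'}"
    using slice_eq_iff[OF assms(1,2)] by blast
  also have "{f \<in> sg_edges n. d \<in> f \<and> h (shift d' ` f) = shift d d'}
      = {f \<in> sg_edges n. d \<in> f \<and> slice n d' h f = d}"
    using slice_eq_iff[OF assms(1,3)] unfolding shift_commute[of d d'] by blast
  finally show ?thesis by (simp add: indeg_def)
qed

lemma interior_Suc:
  "sg_verts (Suc n) - corners (Suc n)
    = {shift d p |d p. d \<in> corners n \<and> p \<in> sg_verts n - corners n}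
    \<union> {shift d d' |d d'. d \<in> corners n \<and> d' \<in> corners n \<and> d \<noteq> d'}"
proof -
  have "shift d p \<notin> corners (Suc n)" if "d \<in> corners n" "p \<in> sg_verts n" "p \<noteq> d" for d p
  proof
    assume "shift d p \<in> corners (Suc n)"
    then obtain c where c: "c \<in> corners n" "shift d p = shift c c" unfolding corners_Suc by blast
    then have "c \<in> sg_verts n" using corners_subset_verts by blast
    then show False using shift_eqD[of d p c c n] c that by (cases "c = d") auto
  qed
  note not_corner = this
  show ?thesis (is "_ = ?I \<union> ?J")
  proof (intro equalityI subsetI)
    fix v assume v: "v \<in> sg_verts (Suc n) - corners (Suc n)"
    then have "v \<in> sg_verts (Suc n)" by blast
    then show "v \<in> ?I \<union> ?J"
    proof (cases rule: verts_Suc_cases)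
      case (corner d)
      then show ?thesis using v unfolding corners_Suc by blast
    qed blast+
  next
    fix v assume "v \<in> ?I \<union> ?J"
    then obtain d p where "v = shift d p" "d \<in> corners n" "p \<in> sg_verts n" "p \<noteq> d"
      using corners_subset_verts[of n] by blast
    then show "v \<in> sg_verts (Suc n) - corners (Suc n)"
      using not_corner unfolding sg_verts_Suc by blast
  qed
qed

text \<open>Vertices inside a copy are constrained within that copy alone; gluing adds only the
  conditions at the three joints, where the in-degrees from two copies add up.\<close>

lemma ice_configs_Suc:
  assumes "h \<in> orientations (Suc n)"
  shows "h \<in> ice_configs (Suc n) \<longleftrightarrow>
    (\<forall>d\<in>corners n. slice n d h \<in> ice_configs n) \<and>
    (\<forall>d\<in>corners n. \<forall>d'\<in>corners n. d \<noteq> d' \<longrightarrow>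
       indeg n (slice n d h) d' + indeg n (slice n d' h) d = 2)"
proof -
  have "h \<in> ice_configs (Suc n) \<longleftrightarrow>
    (\<forall>d\<in>corners n. \<forall>p\<in>sg_verts n - corners n. indeg (Suc n) h (shift d p) = 2) \<and>
    (\<forall>d\<in>corners n. \<forall>d'\<in>corners n. d \<noteq> d' \<longrightarrow> indeg (Suc n) h (shift d d') = 2)"
    unfolding ice_configs_iff interior_Suc using assms by blast
  then show ?thesis
    using indeg_interior[OF assms] indeg_joint[OF assms] slice_orientations[OF assms]
    by (simp add: ice_configs_iff)
qed

text \<open>
  Of the two edges at an outmost vertex, the one preceding the vertex in the clockwise order
  L, T, R of the boundary comes first.
\<close>

type_synonym corner_state = "bool \<times> bool"

definition state_L :: "nat \<Rightarrow> (point set \<Rightarrow> point) \<Rightarrow> corner_state" where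
  "state_L n h = (h {(0, 0), (1, 0)} = vL n, h {(0, 0), (0, 1)} = vL n)"

definition state_R :: "nat \<Rightarrow> (point set \<Rightarrow> point) \<Rightarrow> corner_state" where
  "state_R n h = (h {(2 ^ n, 0), (2 ^ n - 1, 1)} = vR n, h {(2 ^ n, 0), (2 ^ n - 1, 0)} = vR n)"

definition state_T :: "nat \<Rightarrow> (point set \<Rightarrow> point) \<Rightarrow> corner_state" where
  "state_T n h = (h {(0, 2 ^ n), (0, 2 ^ n - 1)} = vT n, h {(0, 2 ^ n), (1, 2 ^ n - 1)} = vT n)"

fun in_count :: "corner_state \<Rightarrow> nat" where
  "in_count (x, y) = of_bool x + of_bool y"

lemma indeg_doubleton:
  assumes "{e \<in> sg_edges n. v \<in> e} = {e1, e2}" "e1 \<noteq> e2"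
  shows "indeg n h v = of_bool (h e1 = v) + of_bool (h e2 = v)"
proof -
  have "{e \<in> sg_edges n. v \<in> e \<and> h e = v} = {e \<in> {e1, e2}. h e = v}"
    unfolding assms(1)[symmetric] by blast
  also have "\<dots> = (if h e1 = v then {e1} else {}) \<union> (if h e2 = v then {e2} else {})" by auto
  finally show ?thesis using assms(2) by (simp add: indeg_def)
qed

lemma indeg_corner:
  "indeg n h (vL n) = in_count (state_L n h)"
  "indeg n h (vR n) = in_count (state_R n h)"
  "indeg n h (vT n) = in_count (state_T n h)"
  unfolding state_L_def state_R_def state_T_def in_count.simps
  by (rule indeg_doubleton[OF incident_corner(1)], simp add: doubleton_eq_iff)
     (rule indeg_doubleton[OF incident_corner(2)], simp add: doubleton_eq_iff,
      rule indeg_doubleton[OF incident_corner(3)], simp add: doubleton_eq_iff)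

lemma incident_cornerD:
  "{(0, 0), (1, 0)} \<in> sg_edges n" "{(0, 0), (0, 1)} \<in> sg_edges n"
  "{(2 ^ n, 0), (2 ^ n - 1, 1)} \<in> sg_edges n" "{(2 ^ n, 0), (2 ^ n - 1, 0)} \<in> sg_edges n"
  "{(0, 2 ^ n), (0, 2 ^ n - 1)} \<in> sg_edges n" "{(0, 2 ^ n), (1, 2 ^ n - 1)} \<in> sg_edges n"
proof -
  have D: "a \<in> S" "b \<in> S" if "{e \<in> S. P e} = {a, b}" for a b :: "point set" and S P
    using that by auto
  show "{(0, 0), (1, 0)} \<in> sg_edges n" "{(0, 0), (0, 1)} \<in> sg_edges n"
    by (rule D[OF incident_corner(1)])+
  show "{(2 ^ n, 0), (2 ^ n - 1, 1)} \<in> sg_edges n" "{(2 ^ n, 0), (2 ^ n - 1, 0)} \<in> sg_edges n"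
    by (rule D[OF incident_corner(2)])+
  show "{(0, 2 ^ n), (0, 2 ^ n - 1)} \<in> sg_edges n" "{(0, 2 ^ n), (1, 2 ^ n - 1)} \<in> sg_edges n"
    by (rule D[OF incident_corner(3)])+
qed

lemma state_Suc:
  assumes "h \<in> orientations (Suc n)"
  shows "state_L (Suc n) h = state_L n (slice n (vL n) h)"
    and "state_R (Suc n) h = state_R n (slice n (vR n) h)"
    and "state_T (Suc n) h = state_T n (slice n (vT n) h)"
proof -
  have pow: "2 ^ Suc n = (2 ^ n + 2 ^ n :: nat)" "2 ^ n + 2 ^ n - 1 = 2 ^ n + (2 ^ n - 1 :: nat)"
    by (simp_all add: mult_2)
  have eq: "vL (Suc n) = shift (vL n) (vL n)" "vR (Suc n) = shift (vR n) (vR n)"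
    "vT (Suc n) = shift (vT n) (vT n)" by (auto simp: corner_defs mult_2)
  note simps = image_insert image_empty shift_Pair add_0_left add_0_right
  have c: "vL n \<in> corners n" "vR n \<in> corners n" "vT n \<in> corners n"
    by (auto simp: corners_def)
  note iff = slice_eq_iff[OF assms]
  show "state_L (Suc n) h = state_L n (slice n (vL n) h)"
    unfolding state_L_def eq iff[OF c(1) incident_cornerD(1)] iff[OF c(1) incident_cornerD(2)]
    by (simp only: simps vL_def)
  show "state_R (Suc n) h = state_R n (slice n (vR n) h)"
    unfolding state_R_def eq iff[OF c(2) incident_cornerD(3)] iff[OF c(2) incident_cornerD(4)] pow
    by (simp only: simps vR_def)
  show "state_T (Suc n) h = state_T n (slice n (vT n) h)"
    unfolding state_T_def eq iff[OF c(3) incident_cornerD(5)] iff[OF c(3) incident_cornerD(6)] pow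
    by (simp only: simps vT_def)
qed

section \<open>Counting configurations with prescribed corner states\<close>

definition configs :: "nat \<Rightarrow> corner_state \<Rightarrow> corner_state \<Rightarrow> corner_state
    \<Rightarrow> (point set \<Rightarrow> point) set" where
  "configs n l r t = {h \<in> ice_configs n. state_L n h = l \<and> state_R n h = r \<and> state_T n h = t}"

lemma finite_ice_configs [simp]: "finite (ice_configs n)"
  using finite_subset[OF _ finite_orientations, of "ice_configs n" n] by (auto simp: ice_configs_def)

lemma finite_configs [simp]: "finite (configs n l r t)"
  by (simp add: configs_def)

lemma configs_subset: "configs n l r t \<subseteq> orientations n"
  by (auto simp: configs_def ice_configs_iff)

text \<open>Pairs of corner states that can meet at a joint: the ice rule asks for total in-degree 2
  there.\<close>

definition matching :: "(corner_state \<times> corner_state) set" where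
  "matching = {(p, q). in_count p + in_count q = 2}"

lemma matching_eq:
  "matching = {((False, False), (True, True)), ((True, True), (False, False)),
    ((True, False), (True, False)), ((True, False), (False, True)),
    ((False, True), (True, False)), ((False, True), (False, True))}"
proof -
  have "x \<in> matching \<longleftrightarrow> x \<in> {((False, False), (True, True)), ((True, True), (False, False)),
    ((True, False), (True, False)), ((True, False), (False, True)),
    ((False, True), (True, False)), ((False, True), (False, True))}" for x
    by (cases x rule: prod.exhaust, rename_tac p q, case_tac p, case_tac q)
       (auto simp: matching_def of_bool_def split: if_splits)
  then show ?thesis by blast
qed

text \<open>The pairs \<open>(p1, q1)\<close>, \<open>(p2, q2)\<close>, \<open>(p3, q3)\<close> are
  the states at the joints L-R, L-T and R-T, seen from the first-named and from the second-named
  copy.\<close>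

lemma bij_betw_configs_Suc:
  "bij_betw (\<lambda>h. (slice n (vL n) h, slice n (vR n) h, slice n (vT n) h))
     (configs (Suc n) l r t)
     (\<Union>((p1, q1), (p2, q2), (p3, q3)) \<in> matching \<times> matching \<times> matching.
        configs n l p1 p2 \<times> configs n q1 r p3 \<times> configs n q2 q3 t)"
  (is "bij_betw ?s _ ?U")
proof -
  note sub = configs_subset[of "Suc n" l r t]
  have ne: "vL n \<noteq> vR n" "vL n \<noteq> vT n" "vR n \<noteq> vT n" by (auto simp: corner_defs)
  have mem: "(x, y, z) \<in> ?U \<longleftrightarrow> x \<in> ice_configs n \<and> y \<in> ice_configs n \<and> z \<in> ice_configs n \<and>
      (state_R n x, state_L n y) \<in> matching \<and> (state_T n x, state_L n z) \<in> matching \<and>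
      (state_T n y, state_R n z) \<in> matching \<and>
      state_L n x = l \<and> state_R n y = r \<and> state_T n z = t" (is "_ \<longleftrightarrow> ?P") for x y z
  proof
    assume ?P
    then show "(x, y, z) \<in> ?U"
      by (intro UN_I[of "((state_R n x, state_L n y), (state_T n x, state_L n z),
            (state_T n y, state_R n z))"]) (simp_all add: configs_def)
  qed (clarsimp simp: configs_def)
  have key: "h \<in> configs (Suc n) l r t \<longleftrightarrow> ?s h \<in> ?U" if h: "h \<in> orientations (Suc n)" for h
  proof -
    have "h \<in> configs (Suc n) l r t \<longleftrightarrow>
        slice n (vL n) h \<in> ice_configs n \<and> slice n (vR n) h \<in> ice_configs n \<and>
        slice n (vT n) h \<in> ice_configs n \<and>
        (state_R n (slice n (vL n) h), state_L n (slice n (vR n) h)) \<in> matching \<and>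
        (state_T n (slice n (vL n) h), state_L n (slice n (vT n) h)) \<in> matching \<and>
        (state_T n (slice n (vR n) h), state_R n (slice n (vT n) h)) \<in> matching \<and>
        state_L n (slice n (vL n) h) = l \<and> state_R n (slice n (vR n) h) = r \<and>
        state_T n (slice n (vT n) h) = t"
      using ne by (auto simp: configs_def ice_configs_Suc[OF h] state_Suc[OF h] matching_def
          corners_def indeg_corner add.commute)
    also have "\<dots> \<longleftrightarrow> ?s h \<in> ?U" unfolding mem by blast
    finally show ?thesis .
  qed
  have "?U \<subseteq> orientations n \<times> orientations n \<times> orientations n"
    by (auto simp: configs_def ice_configs_def)
  then have "?U \<subseteq> ?s ` orientations (Suc n)"
    using bij_betw_imp_surj_on[OF bij_betw_slices[of n]] by blast
  then have "?s ` configs (Suc n) l r t = ?U" using key sub by blast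
  moreover have "inj_on ?s (configs (Suc n) l r t)"
    using inj_on_subset[OF bij_betw_imp_inj_on[OF bij_betw_slices] sub] .
  ultimately show ?thesis by (simp add: bij_betw_def)
qed

lemma card_configs_Suc:
  "card (configs (Suc n) l r t) =
     (\<Sum>(p1, q1)\<in>matching. \<Sum>(p2, q2)\<in>matching. \<Sum>(p3, q3)\<in>matching.
        card (configs n l p1 p2) * card (configs n q1 r p3) * card (configs n q2 q3 t))"
proof -
  let ?F = "\<lambda>((p1, q1), (p2, q2), (p3, q3)).
    configs n l p1 p2 \<times> configs n q1 r p3 \<times> configs n q2 q3 t"
  have fin: "finite matching" by (simp add: matching_eq)
  have "card (configs (Suc n) l r t) = card (\<Union>k\<in>matching \<times> matching \<times> matching. ?F k)"
    using bij_betw_same_card[OF bij_betw_configs_Suc] .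
  \<comment> \<open>The pieces are disjoint because a triple of configurations determines its own
    states at the joints.\<close>
  also have "\<dots> = (\<Sum>k\<in>matching \<times> matching \<times> matching. card (?F k))"
    using fin by (intro card_UN_disjoint) (auto simp: configs_def)
  also have "\<dots> = (\<Sum>(p1, q1)\<in>matching. \<Sum>(p2, q2)\<in>matching. \<Sum>(p3, q3)\<in>matching.
        card (configs n l p1 p2) * card (configs n q1 r p3) * card (configs n q2 q3 t))"
    by (simp add: sum.cartesian_product' split_def card_cartesian_product mult.assoc)
  finally show ?thesis .
qed

section \<open>The recursion for the four classes\<close>

text \<open>
  For in-degrees (0,1,2), the class \<open>a\<close> is that in which the flow through the vertex of in-degree 1
  is directed from the vertex of in-degree 0 to that of in-degree 2.
\<close>

definition weight :: "nat \<Rightarrow> nat \<Rightarrow> nat \<Rightarrow> nat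
    \<Rightarrow> corner_state \<Rightarrow> corner_state \<Rightarrow> corner_state \<Rightarrow> nat" where
  "weight a b c d l r t =
    (if in_count l + in_count r + in_count t \<noteq> 3 then 0
     else if in_count l = 1 \<and> in_count r = 1 \<and> in_count t = 1 then (if l = r \<and> r = t then d else c)
     else if in_count l = 1 then (if fst l \<longleftrightarrow> in_count r = 0 then a else b)
     else if in_count r = 1 then (if fst r \<longleftrightarrow> in_count t = 0 then a else b)
     else (if fst t \<longleftrightarrow> in_count l = 0 then a else b))"

text \<open>The triangle has eight orientations: six acyclic ones, whose boundary states are all of
  class \<open>a\<close>, and two cyclic ones of class \<open>d\<close>. Hence the initial
  values.\<close>

fun class_counts :: "nat \<Rightarrow> nat \<times> nat \<times> nat \<times> nat" where
  "class_counts 0 = (1, 0, 0, 1)"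
| "class_counts (Suc n) = (case class_counts n of (a, b, c, d) \<Rightarrow>
     ((a + b)^2 * (d + 3 * c + a), (a + b)^2 * (d + 3 * c + b),
      (d + 3 * c)^3 + a * b * (a + b), (d + 3 * c)^3 + a^3 + b^3))"

lemma sum_matching:
  "(\<Sum>(p, q)\<in>matching. f p q) =
    f (False, False) (True, True) + f (True, True) (False, False) +
    f (True, False) (True, False) + f (True, False) (False, True) +
    f (False, True) (True, False) + (f (False, True) (False, True) :: nat)"
  by (simp add: matching_eq)

text \<open>If all outer in-degrees are 1, either all joint states have in-degree 1, and each copy,
  with two free states, contributes \<open>d + 3 * c\<close>; or in-degrees 0 and 2 alternate around
  the joints in one of two senses, and each copy contributes \<open>a\<close> or \<open>b\<close>.
  If the outer in-degrees are 0, 1, 2, the copies with 0 and 2 contribute \<open>a + b\<close> each,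
  and the copy with 1 contributes \<open>d + 3 * c\<close> or a single \<open>a\<close> or
  \<open>b\<close>. The proof evaluates all 64 boundary states.\<close>

lemma weight_recursion:
  "(\<Sum>(p1, q1)\<in>matching. \<Sum>(p2, q2)\<in>matching. \<Sum>(p3, q3)\<in>matching.
      weight a b c d l p1 p2 * weight a b c d q1 r p3 * weight a b c d q2 q3 t)
   = weight ((a + b)^2 * (d + 3 * c + a)) ((a + b)^2 * (d + 3 * c + b))
       ((d + 3 * c)^3 + a * b * (a + b)) ((d + 3 * c)^3 + a^3 + b^3) l r t"
proof -
  obtain l1 l2 r1 r2 t1 t2 where "l = (l1, l2)" "r = (r1, r2)" "t = (t1, t2)"
    by (metis surj_pair)
  then show ?thesis
    by (cases l1; cases l2; cases r1; cases r2; cases t1; cases t2)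
       (simp_all add: sum_matching weight_def,
        simp_all add: power2_eq_square power3_eq_cube algebra_simps)
qed

section \<open>The single triangle\<close>

text \<open>Each bit is \<open>True\<close> when its edge runs clockwise, along the cycle L, T,
  R.\<close>

lemma bij_betw_orientations_0:
  "bij_betw (\<lambda>h. (h {vL 0, vR 0} = vL 0, h {vL 0, vT 0} = vT 0, h {vT 0, vR 0} = vR 0))
     (orientations 0) UNIV"
  (is "bij_betw ?s _ _")
proof -
  have ne: "vL 0 \<noteq> vR 0" "vL 0 \<noteq> vT 0" "vR 0 \<noteq> vT 0" by (auto simp: corner_defs)
  have "inj_on ?s (orientations 0)"
  proof (rule inj_onI)
    fix h h' assume h: "h \<in> orientations 0" "h' \<in> orientations 0" "?s h = ?s h'"
    have mem: "h e \<in> e" "h' e \<in> e" if "e \<in> sg_edges 0" for e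
      using h(1,2) that unfolding orientations_def by (blast intro: PiE_mem)+
    show "h = h'"
    proof (rule PiE_ext[OF h(1,2)[unfolded orientations_def]])
      fix e assume "e \<in> sg_edges 0"
      then show "h e = h' e" using mem[of e] h(3) by auto
    qed
  qed
  moreover have "w \<in> ?s ` orientations 0" for w
  proof -
    obtain x y z where w: "w = (x, y, z)" by (cases w)
    define h where "h = (\<lambda>e\<in>sg_edges 0. if e = {vL 0, vR 0} then if x then vL 0 else vR 0
      else if e = {vL 0, vT 0} then if y then vT 0 else vL 0 else if z then vR 0 else vT 0)"
    have "h \<in> orientations 0" by (auto simp: h_def orientations_def PiE_iff)
    moreover have "?s h = w" using ne by (auto simp: h_def w doubleton_eq_iff)
    ultimately show ?thesis by blast
  qed
  ultimately show ?thesis by (auto simp: bij_betw_def)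
qed

text \<open>Every edge is seen from both ends, so a boundary state admits at most one orientation,
  and it admits one exactly when each edge is seen as incoming at just one end.\<close>

lemma card_configs_0: "card (configs 0 l r t) = weight 1 0 0 1 l r t"
proof -
  let ?s = "\<lambda>h. (h {vL 0, vR 0} = vL 0, h {vL 0, vT 0} = vT 0, h {vT 0, vR 0} = vR 0)"
  let ?X = "{(x, y, z). l = (x, \<not> y) \<and> r = (z, \<not> x) \<and> t = (y, \<not> z)}"
  have key: "h \<in> configs 0 l r t \<longleftrightarrow> ?s h \<in> ?X" if h: "h \<in> orientations 0" for h
  proof -
    have "sg_verts 0 - corners 0 = {}" by (simp add: corners_def)
    then have "h \<in> ice_configs 0" using h unfolding ice_configs_iff by simp
    moreover have "h e \<in> e" if "e \<in> sg_edges 0" for e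
      using h that unfolding orientations_def by (blast intro: PiE_mem)
    from this[of "{vL 0, vR 0}"] this[of "{vL 0, vT 0}"] this[of "{vT 0, vR 0}"]
    have "h {vL 0, vR 0} = vR 0 \<longleftrightarrow> h {vL 0, vR 0} \<noteq> vL 0"
      "h {vL 0, vT 0} = vL 0 \<longleftrightarrow> h {vL 0, vT 0} \<noteq> vT 0"
      "h {vT 0, vR 0} = vT 0 \<longleftrightarrow> h {vT 0, vR 0} \<noteq> vR 0"
      by (auto simp: corner_defs)
    then have "state_L 0 h = (h {vL 0, vR 0} = vL 0, h {vL 0, vT 0} \<noteq> vT 0)"
      "state_R 0 h = (h {vT 0, vR 0} = vR 0, h {vL 0, vR 0} \<noteq> vL 0)"
      "state_T 0 h = (h {vL 0, vT 0} = vT 0, h {vT 0, vR 0} \<noteq> vR 0)"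
      by (simp_all add: state_L_def state_R_def state_T_def corner_defs insert_commute)
    ultimately show ?thesis by (auto simp: configs_def)
  qed
  have sub: "configs 0 l r t \<subseteq> orientations 0" by (rule configs_subset)
  have "?s ` configs 0 l r t = ?X"
  proof (intro equalityI subsetI)
    fix w assume w: "w \<in> ?X"
    have "w \<in> ?s ` orientations 0"
      unfolding bij_betw_imp_surj_on[OF bij_betw_orientations_0] by (rule UNIV_I)
    then obtain h where h: "w = ?s h" "h \<in> orientations 0" by (rule imageE)
    have "h \<in> configs 0 l r t" using w unfolding h(1) key[OF h(2), symmetric] .
    then show "w \<in> ?s ` configs 0 l r t" unfolding h(1) by (rule imageI)
  next
    fix w assume "w \<in> ?s ` configs 0 l r t"
    then obtain h where h: "w = ?s h" "h \<in> configs 0 l r t" by (rule imageE)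
    show "w \<in> ?X" unfolding h(1) key[OF subsetD[OF sub h(2)], symmetric] by (rule h(2))
  qed
  with sub have "bij_betw ?s (configs 0 l r t) ?X"
    by (rule bij_betw_subset[OF bij_betw_orientations_0])
  then have "card (configs 0 l r t) = card ?X" by (rule bij_betw_same_card)
  also have "?X = (if snd l \<noteq> fst t \<and> snd r \<noteq> fst l \<and> snd t \<noteq> fst r
      then {(fst l, fst t, fst r)} else {})"
    by (cases l; cases r; cases t) auto
  also have "card \<dots> = weight 1 0 0 1 l r t"
  proof -
    obtain l1 l2 r1 r2 t1 t2 where "l = (l1, l2)" "r = (r1, r2)" "t = (t1, t2)"
      by (metis surj_pair)
    then show ?thesis
      by (cases l1; cases l2; cases r1; cases r2; cases t1; cases t2) (simp_all add: weight_def)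
  qed
  finally show ?thesis .
qed

lemma card_configs:
  "class_counts n = (a, b, c, d) \<Longrightarrow> card (configs n l r t) = weight a b c d l r t"
proof (induction n arbitrary: a b c d l r t)
  case 0
  then have "a = 1" "b = 0" "c = 0" "d = 1" by simp_all
  then show ?case by (simp only: card_configs_0)
next
  case (Suc n)
  obtain a' b' c' d' where abcd: "class_counts n = (a', b', c', d')" by (cases "class_counts n")
  then show ?case
    using Suc.prems unfolding card_configs_Suc Suc.IH[OF abcd] weight_recursion by auto
qed

section \<open>The counts \<open>pc\<close>, \<open>pd\<close> and \<open>I_count\<close> in terms
  of the four classes\<close>

lemma edge_in_iff:
  "edge_in n h (vL n) (side_LR n) \<longleftrightarrow> fst (state_L n h)"
  "edge_in n h (vR n) (side_TR n) \<longleftrightarrow> fst (state_R n h)"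
  "edge_in n h (vT n) (side_LT n) \<longleftrightarrow> fst (state_T n h)"
  "edge_in n h (vT n) (side_TR n) \<longleftrightarrow> snd (state_T n h)"
proof -
  have *: "edge_in n h v s \<longleftrightarrow> (\<exists>e\<in>{e \<in> sg_edges n. v \<in> e}. e \<subseteq> s \<and> h e = v)" for v s
    by (auto simp: edge_in_def)
  \<comment> \<open>The edge at R or T that does not lie on TR has an endpoint with coordinate sum
    \<open>2 ^ n - 1\<close>; this keeps it off \<open>side_TR n\<close>.\<close>
  have [simp]: "2 ^ n - Suc 0 \<noteq> 2 ^ n" by (rule less_imp_neq) simp
  show "edge_in n h (vL n) (side_LR n) \<longleftrightarrow> fst (state_L n h)"
    "edge_in n h (vR n) (side_TR n) \<longleftrightarrow> fst (state_R n h)"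
    "edge_in n h (vT n) (side_LT n) \<longleftrightarrow> fst (state_T n h)"
    "edge_in n h (vT n) (side_TR n) \<longleftrightarrow> snd (state_T n h)"
    unfolding * incident_corner
    by (simp_all add: side_LR_def side_TR_def side_LT_def state_L_def state_R_def state_T_def)
qed

lemma edge_out_iff:
  "edge_out n h (vL n) (side_LT n) \<longleftrightarrow> \<not> snd (state_L n h)"
  "edge_out n h (vR n) (side_LR n) \<longleftrightarrow> \<not> snd (state_R n h)"
  "edge_out n h (vT n) (side_LT n) \<longleftrightarrow> \<not> fst (state_T n h)"
  "edge_out n h (vT n) (side_TR n) \<longleftrightarrow> \<not> snd (state_T n h)"
proof -
  have *: "edge_out n h v s \<longleftrightarrow> (\<exists>e\<in>{e \<in> sg_edges n. v \<in> e}. e \<subseteq> s \<and> h e \<noteq> v)" for v s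
    by (auto simp: edge_out_def)
  have [simp]: "2 ^ n - Suc 0 \<noteq> 2 ^ n" by (rule less_imp_neq) simp
  show "edge_out n h (vL n) (side_LT n) \<longleftrightarrow> \<not> snd (state_L n h)"
    "edge_out n h (vR n) (side_LR n) \<longleftrightarrow> \<not> snd (state_R n h)"
    "edge_out n h (vT n) (side_LT n) \<longleftrightarrow> \<not> fst (state_T n h)"
    "edge_out n h (vT n) (side_TR n) \<longleftrightarrow> \<not> snd (state_T n h)"
    unfolding * incident_corner
    by (simp_all add: side_LR_def side_TR_def side_LT_def state_L_def state_R_def state_T_def)
qed

text \<open>All in-degrees are 1, and T is passed in the sense opposite to L and R, which is class
  \<open>c\<close>.\<close>

lemma pc_eq: "pc n = fst (snd (snd (class_counts n)))"
proof -
  obtain a b c d where abcd: "class_counts n = (a, b, c, d)" by (cases "class_counts n")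
  have "pc n = card (configs n (True, False) (True, False) (False, True))"
    unfolding pc_def configs_def edge_in_iff edge_out_iff
    by (intro arg_cong[where f = card] Collect_cong) (auto simp: prod_eq_iff)
  then show ?thesis using card_configs[OF abcd] abcd by (simp add: weight_def)
qed

text \<open>Here all three corners are passed in the same sense, which is class
  \<open>d\<close>.\<close>

lemma pd_eq: "pd n = snd (snd (snd (class_counts n)))"
proof -
  obtain a b c d where abcd: "class_counts n = (a, b, c, d)" by (cases "class_counts n")
  have "pd n = card (configs n (True, False) (True, False) (True, False))"
    unfolding pd_def configs_def edge_in_iff edge_out_iff
    by (intro arg_cong[where f = card] Collect_cong) (auto simp: prod_eq_iff)
  then show ?thesis using card_configs[OF abcd] abcd by (simp add: weight_def)
qed

text \<open>Of the 64 boundary states, twelve have in-degrees 0, 1, 2, split evenly between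
  \<open>a\<close> and \<open>b\<close>, and eight have in-degrees 1, 1, 1: two of class
  \<open>d\<close> and six of class \<open>c\<close>. The others have weight 0.\<close>

lemma I_count_eq:
  assumes "class_counts n = (a, b, c, d)"
  shows "I_count n = 6 * (a + b) + 2 * (d + 3 * c)"
proof -
  have "ice_configs n = (\<Union>(l, r, t). configs n l r t)" by (auto simp: configs_def)
  then have "I_count n = card (\<Union>k. case k of (l, r, t) \<Rightarrow> configs n l r t)"
    by (simp add: I_count_def)
  also have "\<dots> = (\<Sum>k\<in>UNIV. card (case k of (l, r, t) \<Rightarrow> configs n l r t))"
    by (rule card_UN_disjoint) (auto simp: configs_def)
  also have "\<dots> = (\<Sum>(l, r, t)\<in>UNIV. weight a b c d l r t)"
    using card_configs[OF assms] by (intro sum.cong) auto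
  also have "\<dots> = 6 * (a + b) + 2 * (d + 3 * c)"
    by (simp add: UNIV_Times_UNIV[symmetric] UNIV_bool sum.cartesian_product[symmetric] weight_def
        del: UNIV_Times_UNIV)
  finally show ?thesis .
qed

section \<open>Growth of the counts\<close>

definition cnt_a :: "nat \<Rightarrow> real" where "cnt_a n = real (fst (class_counts n))"
definition cnt_b :: "nat \<Rightarrow> real" where "cnt_b n = real (fst (snd (class_counts n)))"
definition cnt_c :: "nat \<Rightarrow> real" where "cnt_c n = real (fst (snd (snd (class_counts n))))"
definition cnt_d :: "nat \<Rightarrow> real" where "cnt_d n = real (snd (snd (snd (class_counts n))))"

definition "sum_ab n = cnt_a n + cnt_b n"
definition "diff_ab n = cnt_a n - cnt_b n"
definition "sum_cd n = cnt_d n + 3 * cnt_c n"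
definition "diff_cd n = cnt_d n - cnt_c n"

lemmas combination_defs = sum_ab_def diff_ab_def sum_cd_def diff_cd_def

lemma cnt_Suc:
  "cnt_a (Suc n) = sum_ab n ^ 2 * (sum_cd n + cnt_a n)"
  "cnt_b (Suc n) = sum_ab n ^ 2 * (sum_cd n + cnt_b n)"
  "cnt_c (Suc n) = sum_cd n ^ 3 + cnt_a n * cnt_b n * sum_ab n"
  "cnt_d (Suc n) = sum_cd n ^ 3 + cnt_a n ^ 3 + cnt_b n ^ 3"
  unfolding combination_defs cnt_a_def cnt_b_def cnt_c_def cnt_d_def
  by (cases "class_counts n"; simp)+

lemma cnt_nonneg: "cnt_a n \<ge> 0" "cnt_b n \<ge> 0" "cnt_c n \<ge> 0" "cnt_d n \<ge> 0"
  by (simp_all add: cnt_a_def cnt_b_def cnt_c_def cnt_d_def)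

text \<open>The last two identities come from
  \<open>a^3 + b^3 + 3 * a * b * (a + b) = (a + b)^3\<close> and
  \<open>a^3 + b^3 - a * b * (a + b) = (a + b) * (a - b)^2\<close>. The two sums evolve on their
  own, and the differences are driven by \<open>sum_ab\<close> and \<open>diff_ab\<close>.\<close>

lemma combination_Suc:
  "sum_ab (Suc n) = sum_ab n ^ 2 * (2 * sum_cd n + sum_ab n)"
  "diff_ab (Suc n) = sum_ab n ^ 2 * diff_ab n"
  "sum_cd (Suc n) = 4 * sum_cd n ^ 3 + sum_ab n ^ 3"
  "diff_cd (Suc n) = sum_ab n * diff_ab n ^ 2"
  unfolding sum_ab_def[of "Suc n"] diff_ab_def[of "Suc n"] sum_cd_def[of "Suc n"]
    diff_cd_def[of "Suc n"] cnt_Suc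
  by (simp_all add: sum_ab_def diff_ab_def power2_eq_square power3_eq_cube algebra_simps)

lemma combination_1: "sum_ab 1 = 3" "diff_ab 1 = 1" "sum_cd 1 = 5" "diff_cd 1 = 1"
  by (simp_all add: combination_defs cnt_a_def cnt_b_def cnt_c_def cnt_d_def)

lemma combination_2: "sum_ab 2 = 117" "diff_ab 2 = 9" "sum_cd 2 = 527" "diff_cd 2 = 3"
  using combination_Suc[of 1] unfolding combination_1 Suc_1 by simp_all

lemma cnt_d_eq: "4 * cnt_d n = sum_cd n + 3 * diff_cd n"
  by (simp add: sum_cd_def diff_cd_def)

lemma cnt_c_eq: "4 * cnt_c n = sum_cd n - diff_cd n"
  by (simp add: sum_cd_def diff_cd_def)

text \<open>The third estimate makes the last one inductive; for \<open>n = 1\<close> the second one fails.\<close>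

lemma combination_bounds:
  assumes "n \<ge> 2"
  shows "0 < sum_ab n" "2 * sum_ab n \<le> sum_cd n"
    and "sum_ab n ^ 5 \<le> 5 * sum_cd n ^ 3 * diff_ab n ^ 2"
    and "sum_ab n ^ 3 \<le> 9 * sum_cd n ^ 2 * diff_cd n"
proof -
  have "0 < sum_ab n \<and> 2 * sum_ab n \<le> sum_cd n \<and>
    sum_ab n ^ 5 \<le> 5 * sum_cd n ^ 3 * diff_ab n ^ 2 \<and>
    sum_ab n ^ 3 \<le> 9 * sum_cd n ^ 2 * diff_cd n"
    using assms
  proof (induction n rule: dec_induct)
    case base
    show ?case by (simp add: combination_2)
  next
    case (step n)
    define p s x where "p = sum_ab n" and "s = sum_cd n" and "x = diff_ab n"
    have IH: "0 < p" "2 * p \<le> s" "p ^ 5 \<le> 5 * s ^ 3 * x ^ 2"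
      using step.IH by (simp_all add: p_def s_def x_def)
    have s: "0 < s" using IH by linarith
    have Suc: "sum_ab (Suc n) = p ^ 2 * (2 * s + p)" "diff_ab (Suc n) = p ^ 2 * x"
      "sum_cd (Suc n) = 4 * s ^ 3 + p ^ 3" "diff_cd (Suc n) = p * x ^ 2"
      by (simp_all add: combination_Suc p_def s_def x_def)
    \<comment> \<open>The factor 5 / 2, from \<open>p \<le> s / 2\<close>, and the bound
      \<open>s4\<close> enter all three upper estimates below.\<close>
    have lin: "2 * s + p \<le> 5 / 2 * s" using IH by linarith
    have s4: "4 * s ^ 3 \<le> 4 * s ^ 3 + p ^ 3" using IH by simp
    have 1: "0 < p ^ 2 * (2 * s + p)" using IH s by simp
    have 2: "2 * (p ^ 2 * (2 * s + p)) \<le> 4 * s ^ 3 + p ^ 3"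
    proof -
      have "p ^ 2 \<le> (s / 2) ^ 2" using IH by (intro power_mono) auto
      then have "p ^ 2 * (2 * s + p) \<le> (s / 2) ^ 2 * (5 / 2 * s)"
        using lin IH s by (intro mult_mono) auto
      also have "\<dots> \<le> 2 * s ^ 3" using s by (simp add: power2_eq_square power3_eq_cube)
      finally show ?thesis using s4 by linarith
    qed
    \<comment> \<open>Split \<open>p ^ 10\<close> into \<open>p ^ 4 * p * p ^ 5\<close>, bounding
      the single \<open>p\<close> by \<open>s / 2\<close> and \<open>p ^ 5\<close> by the induction
      hypothesis. This closes since 15625 / 64 is below 320 = 5 * 4 ^ 3.\<close>
    have 3: "(p ^ 2 * (2 * s + p)) ^ 5 \<le> 5 * (4 * s ^ 3 + p ^ 3) ^ 3 * (p ^ 2 * x) ^ 2"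
    proof -
      have "(p ^ 2 * (2 * s + p)) ^ 5 \<le> (p ^ 2 * (5 / 2 * s)) ^ 5"
        using lin IH s by (intro power_mono mult_left_mono) auto
      also have "\<dots> = 3125 / 32 * p ^ 4 * s ^ 5 * (p * p ^ 5)"
        by (simp add: power_mult_distrib power_divide eval_nat_numeral)
      also have "\<dots> \<le> 3125 / 32 * p ^ 4 * s ^ 5 * (s / 2 * (5 * s ^ 3 * x ^ 2))"
        using IH s by (intro mult_left_mono mult_mono) auto
      also have "\<dots> = 15625 / 64 * (p ^ 4 * s ^ 9 * x ^ 2)"
        by (simp add: eval_nat_numeral)
      also have "\<dots> \<le> 320 * (p ^ 4 * s ^ 9 * x ^ 2)"
        using IH s by (intro mult_right_mono) auto
      also have "\<dots> = 5 * (4 * s ^ 3) ^ 3 * (p ^ 2 * x) ^ 2"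
        by (simp add: eval_nat_numeral)
      also have "\<dots> \<le> 5 * (4 * s ^ 3 + p ^ 3) ^ 3 * (p ^ 2 * x) ^ 2"
        using s4 s by (intro mult_right_mono mult_left_mono power_mono) auto
      finally show ?thesis .
    qed
    \<comment> \<open>Here \<open>p ^ 6 = p * p ^ 5\<close>, and the hypothesis on
      \<open>p ^ 5\<close> leaves 625 / 8 against 144 = 9 * 4 ^ 2.\<close>
    have 4: "(p ^ 2 * (2 * s + p)) ^ 3 \<le> 9 * (4 * s ^ 3 + p ^ 3) ^ 2 * (p * x ^ 2)"
    proof -
      have "(p ^ 2 * (2 * s + p)) ^ 3 \<le> (p ^ 2 * (5 / 2 * s)) ^ 3"
        using lin IH s by (intro power_mono mult_left_mono) auto
      also have "\<dots> = 125 / 8 * p * s ^ 3 * p ^ 5"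
        by (simp add: power_mult_distrib power_divide eval_nat_numeral)
      also have "\<dots> \<le> 125 / 8 * p * s ^ 3 * (5 * s ^ 3 * x ^ 2)"
        using IH s by (intro mult_left_mono) auto
      also have "\<dots> = 625 / 8 * (p * s ^ 6 * x ^ 2)"
        by (simp add: eval_nat_numeral)
      also have "\<dots> \<le> 144 * (p * s ^ 6 * x ^ 2)"
        using IH s by (intro mult_right_mono) auto
      also have "\<dots> = 9 * (4 * s ^ 3) ^ 2 * (p * x ^ 2)"
        by (simp add: eval_nat_numeral)
      also have "\<dots> \<le> 9 * (4 * s ^ 3 + p ^ 3) ^ 2 * (p * x ^ 2)"
        using s4 s IH by (intro mult_right_mono mult_left_mono power_mono) auto
      finally show ?thesis .
    qed
    show ?case unfolding Suc using 1 2 3 4 by blast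
  qed
  then show "0 < sum_ab n" "2 * sum_ab n \<le> sum_cd n"
    "sum_ab n ^ 5 \<le> 5 * sum_cd n ^ 3 * diff_ab n ^ 2"
    "sum_ab n ^ 3 \<le> 9 * sum_cd n ^ 2 * diff_cd n" by auto
qed

lemma ge_1_cases: "(n::nat) \<ge> 1 \<Longrightarrow> n = 1 \<or> n \<ge> 2"
  by auto

lemma sum_ab_pos: "n \<ge> 1 \<Longrightarrow> 0 < sum_ab n"
  using ge_1_cases[of n] combination_bounds(1)[of n] combination_1 by auto

lemma sum_ab_le: "n \<ge> 1 \<Longrightarrow> sum_ab n \<le> sum_cd n"
  using ge_1_cases[of n] combination_bounds(1,2)[of n] combination_1 by auto

lemma sum_cd_pos: "n \<ge> 1 \<Longrightarrow> 0 < sum_cd n"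
  using sum_ab_pos[of n] sum_ab_le[of n] by linarith

lemma diff_cd_nonneg: "n \<ge> 1 \<Longrightarrow> 0 \<le> diff_cd n"
  by (cases n) (auto simp: combination_Suc sum_ab_def cnt_nonneg)

lemma cnt_c_le: "n \<ge> 1 \<Longrightarrow> 4 * cnt_c n \<le> sum_cd n"
  using diff_cd_nonneg[of n] by (simp add: cnt_c_eq)

lemma cnt_c_pos: "n \<ge> 1 \<Longrightarrow> 0 < cnt_c n"
proof (induction n rule: dec_induct)
  case base
  show ?case by (simp add: cnt_c_def)
next
  case (step n)
  then show ?case using sum_cd_pos[of n] cnt_nonneg
    by (auto simp: cnt_Suc sum_ab_def intro!: add_pos_nonneg)
qed

lemma cnt_d_ge: "n \<ge> 1 \<Longrightarrow> sum_cd n \<le> 4 * cnt_d n"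
  using diff_cd_nonneg[of n] by (simp add: cnt_d_eq)

lemma cnt_d_pos: "n \<ge> 1 \<Longrightarrow> 0 < cnt_d n"
  using cnt_d_ge[of n] sum_cd_pos[of n] by linarith

section \<open>One-step growth of the two bounds\<close>

text \<open>Combines \<open>4 c \<le> s\<close> with \<open>s ^ 3 \<le> c'\<close>. The factor 8
  turns \<open>64 c ^ 3 \<le> c'\<close> into a plain cubing inequality.\<close>

lemma cnt_c_step:
  assumes "n \<ge> 1"
  shows "(8 * cnt_c n) ^ 3 \<le> 8 * cnt_c (Suc n)"
proof -
  have "(4 * cnt_c n) ^ 3 \<le> sum_cd n ^ 3"
    using assms cnt_nonneg cnt_c_le by (intro power_mono) auto
  also have "\<dots> \<le> cnt_c (Suc n)"
    using cnt_nonneg by (simp add: cnt_Suc sum_ab_def)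
  finally show ?thesis by (simp add: power_mult_distrib)
qed

text \<open>For \<open>n \<ge> 2\<close>, \<open>4 d'\<close> exceeds \<open>4 s ^ 3\<close> by at
  most \<open>4 p ^ 3\<close>, hence by at most \<open>36 s ^ 2 u\<close>, which is exactly the
  second term of \<open>4 (s + 3 u) ^ 3\<close>. This is where the constant 9 in
  \<open>combination_bounds\<close> comes from.\<close>

lemma cnt_d_step:
  assumes "n \<ge> 1"
  shows "8 * cnt_d (Suc n) \<le> (8 * cnt_d n) ^ 3"
\<comment> \<open>The estimates start at \<open>n = 2\<close>; the first step compares 1072 with
  4096.\<close>
proof (cases "n = 1")
  case True
  then show ?thesis using cnt_d_eq[of 1] cnt_d_eq[of 2] combination_1 combination_2
    by (simp add: numeral_2_eq_2[symmetric])
next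
  case False
  then have n: "n \<ge> 2" using assms by simp
  define p s x u where "p = sum_ab n" and "s = sum_cd n" and "x = diff_ab n" and "u = diff_cd n"
  have pos: "0 < p" "0 < s" "0 \<le> u" "p ^ 3 \<le> 9 * s ^ 2 * u"
    using combination_bounds[OF n] sum_cd_pos[OF assms] diff_cd_nonneg[OF assms]
    by (simp_all add: p_def s_def u_def)
  have "x ^ 2 \<le> p ^ 2"
    using cnt_nonneg[of n] unfolding x_def p_def sum_ab_def diff_ab_def
    by (intro abs_le_square_iff[THEN iffD1]) auto
  then have "p * x ^ 2 \<le> p * p ^ 2" using pos by (intro mult_left_mono) auto
  then have x: "p * x ^ 2 \<le> p ^ 3" by (simp add: power2_eq_square power3_eq_cube)
  have "4 * cnt_d (Suc n) = 4 * s ^ 3 + p ^ 3 + 3 * (p * x ^ 2)"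
    unfolding cnt_d_eq combination_Suc by (simp add: p_def s_def x_def)
  also have "\<dots> \<le> 4 * s ^ 3 + 36 * s ^ 2 * u" using x pos(4) by linarith
  also have "\<dots> \<le> 4 * (s + 3 * u) ^ 3"
  proof -
    have "(s + 3 * u) ^ 3 = s ^ 3 + 9 * s ^ 2 * u + (27 * s * u ^ 2 + 27 * u ^ 3)"
      by (simp add: power2_eq_square power3_eq_cube algebra_simps)
    moreover have "0 \<le> 27 * s * u ^ 2 + 27 * u ^ 3" using pos by simp
    ultimately show ?thesis by linarith
  qed
  also have "s + 3 * u = 4 * cnt_d n" by (simp add: cnt_d_eq s_def u_def)
  finally show ?thesis by (simp add: power_mult_distrib)
qed

section \<open>Logarithms scaled by powers of 3 and their limits\<close>

text \<open>Dividing by \<open>3 ^ n\<close> exactly compensates one cubing per step.\<close>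

lemma ln_div_power3_mono:
  fixes f :: "nat \<Rightarrow> real"
  assumes "\<And>n. n \<ge> k \<Longrightarrow> 0 < f n" "\<And>n. n \<ge> k \<Longrightarrow> f n ^ 3 \<le> f (Suc n)"
    and "k \<le> m" "m \<le> n"
  shows "ln (f m) / 3 ^ m \<le> ln (f n) / 3 ^ n"
  using assms(4)
proof (induction n rule: dec_induct)
  case (step i)
  then have i: "k \<le> i" using assms(3) by linarith
  have "3 * ln (f i) = ln (f i ^ 3)" using assms(1)[OF i] by (simp add: ln_realpow)
  also have "\<dots> \<le> ln (f (Suc i))" using assms(1)[of i] assms(1)[of "Suc i"] assms(2)[of i] i by simp
  finally have "ln (f i) / 3 ^ i \<le> ln (f (Suc i)) / 3 ^ Suc i" by (simp add: field_simps)
  with step.IH show ?case by linarith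
qed simp

lemma ln_div_power3_antimono:
  fixes f :: "nat \<Rightarrow> real"
  assumes "\<And>n. n \<ge> k \<Longrightarrow> 0 < f n" "\<And>n. n \<ge> k \<Longrightarrow> f (Suc n) \<le> f n ^ 3"
    and "k \<le> m" "m \<le> n"
  shows "ln (f n) / 3 ^ n \<le> ln (f m) / 3 ^ m"
proof -
  \<comment> \<open>The reciprocals satisfy the opposite inequality, so the increasing case applies
    to them.\<close>
  have "ln (inverse (f m)) / 3 ^ m \<le> ln (inverse (f n)) / 3 ^ n"
  proof (rule ln_div_power3_mono[where k = k and f = "\<lambda>n. inverse (f n)"])
    show "inverse (f n) ^ 3 \<le> inverse (f (Suc n))" if "n \<ge> k" for n
      using assms(1)[of n] assms(1)[of "Suc n"] assms(2)[of n] that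
      by (simp add: power_inverse)
  qed (use assms in auto)
  then show ?thesis using assms(1)[of m] assms(1)[of n] assms(3,4) by (simp add: ln_inverse)
qed

lemma tendsto_const_div_power3: "(\<lambda>n. c / 3 ^ n) \<longlonglongrightarrow> (0::real)"
  using tendsto_mult[OF tendsto_const[of c] LIMSEQ_realpow_zero[of "1/3"]]
  by (simp add: power_divide)

text \<open>Since \<open>8 c \<le> 2 s \<le> 8 d\<close>, the quantity
  \<open>ln (2 s) / 3 ^ n\<close> lies between an increasing and a decreasing sequence, whose values
  at \<open>m\<close> therefore bound its limit. The limit exists because
  \<open>s ^ 3 \<le> s'\<close> makes \<open>ln s / 3 ^ n\<close> increase, and the decreasing
  sequence bounds it.\<close>

lemma ln_sum_cd_limit:
  obtains l where "(\<lambda>n. ln (sum_cd n) / 3 ^ n) \<longlonglongrightarrow> l"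
    and "\<And>m. m \<ge> 1 \<Longrightarrow> ln (8 * cnt_c m) / 3 ^ m \<le> l"
    and "\<And>m. m \<ge> 1 \<Longrightarrow> l \<le> ln (8 * cnt_d m) / 3 ^ m"
proof -
  let ?f = "\<lambda>n. ln (sum_cd n) / 3 ^ n"
  \<comment> \<open>The term \<open>ln 2 / 3 ^ n\<close> converts \<open>ln s\<close> into
    \<open>ln (2 s)\<close> and vanishes in the limit.\<close>
  have ge: "?f n + ln 2 / 3 ^ n \<ge> ln (8 * cnt_c m) / 3 ^ m" if "1 \<le> m" "m \<le> n" for m n
  proof -
    have n: "n \<ge> 1" using that by simp
    have "ln (8 * cnt_c m) / 3 ^ m \<le> ln (8 * cnt_c n) / 3 ^ n"
      using that cnt_c_pos cnt_c_step by (intro ln_div_power3_mono[where k = 1 and f = "\<lambda>n. 8 * cnt_c n"]) auto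
    also have "ln (8 * cnt_c n) \<le> ln (2 * sum_cd n)"
      using cnt_c_le[OF n] cnt_c_pos[OF n] sum_cd_pos[OF n] by simp
    also have "\<dots> = ln (sum_cd n) + ln 2" using sum_cd_pos[OF n] by (simp add: ln_mult)
    finally show ?thesis by (simp add: add_divide_distrib divide_right_mono)
  qed
  have le: "?f n + ln 2 / 3 ^ n \<le> ln (8 * cnt_d m) / 3 ^ m" if "1 \<le> m" "m \<le> n" for m n
  proof -
    have n: "n \<ge> 1" using that by simp
    have "?f n + ln 2 / 3 ^ n = ln (2 * sum_cd n) / 3 ^ n"
      using sum_cd_pos[OF n] by (simp add: ln_mult add_divide_distrib)
    also have "\<dots> \<le> ln (8 * cnt_d n) / 3 ^ n"
      using cnt_d_ge[OF n] cnt_d_pos[OF n] sum_cd_pos[OF n] by (intro divide_right_mono) auto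
    also have "\<dots> \<le> ln (8 * cnt_d m) / 3 ^ m"
      using that cnt_d_pos cnt_d_step by (intro ln_div_power3_antimono[where k = 1 and f = "\<lambda>n. 8 * cnt_d n"]) auto
    finally show ?thesis .
  qed
  have incr: "?f (Suc m) \<le> ?f (Suc n)" if "m \<le> n" for m n
  proof (rule ln_div_power3_mono[where k = 1 and f = sum_cd])
    show "sum_cd n ^ 3 \<le> sum_cd (Suc n)" if "n \<ge> 1" for n
    proof -
      have "0 \<le> sum_ab n ^ 3" "0 \<le> sum_cd n ^ 3"
        using sum_ab_pos[OF that] sum_cd_pos[OF that] by simp_all
      then show ?thesis unfolding combination_Suc by linarith
    qed
  qed (use that sum_cd_pos in auto)
  have "?f (Suc n) \<le> ln (8 * cnt_d 1) / 3 ^ 1" for n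
  proof -
    have "0 \<le> ln 2 / (3::real) ^ Suc n" by simp
    then show ?thesis using le[of 1 "Suc n"] by linarith
  qed
  moreover have "incseq (\<lambda>n. ?f (Suc n))" unfolding incseq_def using incr by blast
  ultimately obtain l where "(\<lambda>n. ?f (Suc n)) \<longlonglongrightarrow> l"
    using incseq_convergent[of "\<lambda>n. ?f (Suc n)"] by blast
  then have l: "?f \<longlonglongrightarrow> l" by (rule LIMSEQ_imp_Suc)
  have l': "(\<lambda>n. ?f n + ln 2 / 3 ^ n) \<longlonglongrightarrow> l"
    using tendsto_add[OF l tendsto_const_div_power3[of "ln 2"]] by simp
  show thesis
  proof (rule that[OF l])
    fix m :: nat assume "m \<ge> 1"
    then show "ln (8 * cnt_c m) / 3 ^ m \<le> l"
      using ge by (intro LIMSEQ_le_const[OF l']) auto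
    show "l \<le> ln (8 * cnt_d m) / 3 ^ m"
      using le \<open>m \<ge> 1\<close> by (intro LIMSEQ_le_const2[OF l']) auto
  qed
qed

lemma real_pc: "real (pc n) = cnt_c n"
  by (simp add: pc_eq cnt_c_def)

lemma real_pd: "real (pd n) = cnt_d n"
  by (simp add: pd_eq cnt_d_def)

lemma real_I_count: "real (I_count n) = 6 * sum_ab n + 2 * sum_cd n"
proof -
  obtain a b c d where "class_counts n = (a, b, c, d)" by (cases "class_counts n")
  then show ?thesis
    by (simp add: I_count_eq sum_ab_def sum_cd_def cnt_a_def cnt_b_def cnt_c_def cnt_d_def)
qed

text \<open>Because \<open>p \<le> s\<close>, the count \<open>I = 6 p + 2 s\<close> lies between
  \<open>s\<close> and \<open>8 s\<close>, so the logarithms differ by a bounded amount. The number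
  of vertices is asymptotic to \<open>3 / 2 * 3 ^ n\<close>, whence the factor 2 / 3.\<close>

lemma entropy_seq_tendsto:
  assumes "(\<lambda>n. ln (sum_cd n) / 3 ^ n) \<longlonglongrightarrow> l"
  shows "entropy_seq \<longlonglongrightarrow> 2 / 3 * l"
proof -
  have bounds: "ln (sum_cd n) \<le> ln (real (I_count n))"
    "ln (real (I_count n)) \<le> ln (sum_cd n) + ln 8" if "n \<ge> 1" for n
  proof -
    have *: "0 < sum_ab n" "sum_ab n \<le> sum_cd n" "0 < sum_cd n"
      using that sum_ab_pos sum_ab_le sum_cd_pos by auto
    then show "ln (sum_cd n) \<le> ln (real (I_count n))" by (simp add: real_I_count)
    have "ln (real (I_count n)) \<le> ln (sum_cd n * 8)" using * by (simp add: real_I_count)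
    then show "ln (real (I_count n)) \<le> ln (sum_cd n) + ln 8" using * by (simp add: ln_mult)
  qed
  have upper: "(\<lambda>n. ln (sum_cd n) / 3 ^ n + ln 8 / 3 ^ n) \<longlonglongrightarrow> l"
    using tendsto_add[OF assms tendsto_const_div_power3[of "ln 8"]] by simp
  have "(\<lambda>n. ln (real (I_count n)) / 3 ^ n) \<longlonglongrightarrow> l"
  proof (rule tendsto_sandwich[OF _ _ assms upper])
    show "\<forall>\<^sub>F n in sequentially. ln (sum_cd n) / 3 ^ n \<le> ln (real (I_count n)) / 3 ^ n"
      using bounds(1) by (intro eventually_sequentiallyI[of 1] divide_right_mono) auto
    show "\<forall>\<^sub>F n in sequentially.
        ln (real (I_count n)) / 3 ^ n \<le> ln (sum_cd n) / 3 ^ n + ln 8 / 3 ^ n"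
      using bounds(2) unfolding add_divide_distrib[symmetric]
      by (intro eventually_sequentiallyI[of 1] divide_right_mono) auto
  qed
  moreover have "(\<lambda>n. 3 / 2 * (1 + 1 / 3 ^ n)) \<longlonglongrightarrow> (3 / 2 * (1 + 0) :: real)"
    by (intro tendsto_intros tendsto_const_div_power3)
  ultimately have "(\<lambda>n. ln (real (I_count n)) / 3 ^ n / (3 / 2 * (1 + 1 / 3 ^ n)))
      \<longlonglongrightarrow> l / (3 / 2 * (1 + 0))"
    by (rule tendsto_divide) simp
  moreover have "entropy_seq n = ln (real (I_count n)) / 3 ^ n / (3 / 2 * (1 + 1 / 3 ^ n))" for n
  proof -
    have "2 * real (card (sg_verts n)) = 3 ^ Suc n + 3"
      using arg_cong[OF card_verts[of n], of real] by simp
    moreover have "2 * (3 ^ n * (3 / 2 * (1 + 1 / 3 ^ n))) = (3 ^ Suc n + 3 :: real)"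
      by (simp add: field_simps)
    ultimately have "real (card (sg_verts n)) = 3 ^ n * (3 / 2 * (1 + 1 / 3 ^ n))"
      by linarith
    then show ?thesis by (simp only: entropy_seq_def divide_divide_eq_left)
  qed
  ultimately have "(\<lambda>n. entropy_seq n) \<longlonglongrightarrow> l / (3 / 2 * (1 + 0))" by presburger
  then show ?thesis by (simp add: mult.commute)
qed

theorem lemma3p3:
  shows "convergent entropy_seq \<and>
    (\<forall>m::nat. m \<ge> 1 \<longrightarrow>
       2 / 3 ^ (m + 1) * ln (real (pc m)) + 2 / 3 ^ m * ln 2 \<le> S_I_SG \<and>
       S_I_SG \<le> 2 / 3 ^ (m + 1) * ln (real (pd m)) + 2 / 3 ^ m * ln 2)"
proof -
  obtain l where lim: "(\<lambda>n. ln (sum_cd n) / 3 ^ n) \<longlonglongrightarrow> l"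
    and l: "\<And>m. m \<ge> 1 \<Longrightarrow> ln (8 * cnt_c m) / 3 ^ m \<le> l"
      "\<And>m. m \<ge> 1 \<Longrightarrow> l \<le> ln (8 * cnt_d m) / 3 ^ m"
    using ln_sum_cd_limit by blast
  note tendsto = entropy_seq_tendsto[OF lim]
  have S: "S_I_SG = 2 / 3 * l" unfolding S_I_SG_def using tendsto by (rule limI)
  have ln_8: "ln 8 = 3 * ln (2::real)" using ln_realpow[of 2 3] by simp
  \<comment> \<open>As \<open>8 = 2 ^ 3\<close>, the term with \<open>ln 2\<close> regains a factor
    3, which accounts for the different exponents \<open>m + 1\<close> and \<open>m\<close>.\<close>
  have eq: "2 / 3 ^ (m + 1) * ln x + 2 / 3 ^ m * ln 2 = 2 / 3 * (ln (8 * x) / 3 ^ m)"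
    if "x > 0" for x :: real and m
    using that by (simp add: ln_mult ln_8 field_simps)
  show ?thesis
  proof (intro conjI allI impI)
    show "convergent entropy_seq" using tendsto by (rule convergentI)
    fix m :: nat assume m: "m \<ge> 1"
    show "2 / 3 ^ (m + 1) * ln (real (pc m)) + 2 / 3 ^ m * ln 2 \<le> S_I_SG"
      unfolding real_pc eq[OF cnt_c_pos[OF m]] S using l(1)[OF m] by (intro mult_left_mono) auto
    show "S_I_SG \<le> 2 / 3 ^ (m + 1) * ln (real (pd m)) + 2 / 3 ^ m * ln 2"
      unfolding real_pd eq[OF cnt_d_pos[OF m]] S using l(2)[OF m] by (intro mult_left_mono) auto
  qed
qed

end
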